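(* Let $\mathcal{X}$ and $\mathcal{Y}$ be subspaces of $\mathcal{H}$. Then $$\Lambda\left( (P_{\mathcal{X}} P_{\mathcal{Y}})|_{\mathcal{X}} \right)=[ \cos^2 \Theta(\mathcal{X},\mathcal{Y}),0,\ldots,0],$$ with $\max\{\dim\mathcal{X} - \dim\mathcal{Y},\,0\}$ extra zeros at the end.
   Context: $\mathcal{H}$ is a real or complex vector space of finite dimension equipped with an inner product. $P_{\mathcal{X}}$ denotes the orthogonal projector onto a subspace $\mathcal{X}$ of $\mathcal{H}$, and $(P_{\mathcal{X}}P_{\mathcal{Y}})|_{\mathcal{X}}:\mathcal{X}\to\mathcal{X}$ is the restriction of $P_{\mathcal{X}}P_{\mathcal{Y}}$ to its invariant subspace $\mathcal{X}$ (a Hermitian operator on $\mathcal{X}$). For a Hermitian operator $B$, $\Lambda(B)$ is the vector of all eigenvalues of $B$, counted with multiplicity, in nonincreasing order. For an operator $B:\mathcal{H}\to\mathcal{H}$, $s_1(B)\ge s_2(B)\ge\cdots$ are its singular values in nonincreasing order. Principal angles: for subspaces $\mathcal{X},\mathcal{Y}$ of $\mathcal{H}$ let $m=\min\{\dim\mathcal{X},\dim\mathcal{Y}\}$. The vector of principal angles $\Theta(\mathcal{X},\mathcal{Y})=[\theta_1,\ldots,\theta_m]$, $\theta_i\in[0,\pi/2]$, in nondecreasing order, is defined by $\cos\Theta(\mathcal{X},\mathcal{Y})=[s_1(P_{\mathcal{X}}P_{\mathcal{Y}}),\ldots,s_m(P_{\mathcal{X}}P_{\mathcal{Y}})]$;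 $\cos^2$ is applied componentwise. *)

theory Defs
  imports
    "HOL-Analysis.Analysis"
    "HOL-Library.Multiset"
    "HOL-Library.FuncSet"
    "Jordan_Normal_Form.Conjugate"
begin

text \<open>
  The scalar fields \<open>\<real>\<close> and \<open>\<complex>\<close>, treated uniformly. By the Gelfand--Mazur theorem these are, up to
  isomorphism, the only fields satisfying the axioms: a real normed field with a conjugation that
  satisfies \<open>z z* = |z|\<^sup>2\<close>.
\<close>

class real_or_complex = conjugatable_field + real_normed_field +
  assumes mult_conjugate_eq_norm: "z * conjugate z = scaleR ((norm z)\<^sup>2) 1"

instance real :: real_or_complex
  by intro_classes (simp add: power2_eq_square)

instance complex :: real_or_complex
  by intro_classes (simp add: complex_norm_square scaleR_conv_of_real flip: of_real_power)

text \<open>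
  The space \<open>\<H>\<close> is the whole type \<open>'v\<close>. The inner product is linear in its first argument.
  The set \<open>Basis\<close> only witnesses finite dimension and plays no other role.
\<close>

locale finite_dimensional_inner_product_space =
  finite_dimensional_vector_space smul Basis
  for smul :: "'k::real_or_complex \<Rightarrow> 'v::ab_group_add \<Rightarrow> 'v" and Basis :: "'v set" +
  fixes ip :: "'v \<Rightarrow> 'v \<Rightarrow> 'k"
  assumes ip_add_left: "ip (x + y) z = ip x z + ip y z"
    and ip_scale_left: "ip (smul c x) y = c * ip x y"
    and ip_commute: "ip y x = conjugate (ip x y)"
    and ip_pos: "x \<noteq> 0 \<Longrightarrow> \<exists>r>0. ip x x = of_real r"

definition orth_projector :: "('v::ab_group_add \<Rightarrow> 'v \<Rightarrow> 'k::real_or_complex) \<Rightarrow> 'v set \<Rightarrow> 'v \<Rightarrow> 'v" where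
  "orth_projector ip X v = (THE p. p \<in> X \<and> (\<forall>x\<in>X. ip (v - p) x = 0))"

definition adjoint_op :: "('v::ab_group_add \<Rightarrow> 'v \<Rightarrow> 'k::real_or_complex) \<Rightarrow> ('v \<Rightarrow> 'v) \<Rightarrow> 'v \<Rightarrow> 'v" where
  "adjoint_op ip B = (THE A. \<forall>x y. ip (B x) y = ip x (A y))"

definition eigenspace ::
    "('k::real_or_complex \<Rightarrow> 'v::ab_group_add \<Rightarrow> 'v) \<Rightarrow> 'v set \<Rightarrow> ('v \<Rightarrow> 'v) \<Rightarrow> real \<Rightarrow> 'v set" where
  "eigenspace smul S B \<mu> = {v \<in> S. B v = smul (of_real \<mu>) v}"

text \<open>
  The vector \<open>\<Lambda>(B)\<close> for a Hermitian operator \<open>B\<close> on the subspace \<open>S\<close>: the eigenvalues of such an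
  operator are real, and the multiplicity of an eigenvalue is the dimension of its eigenspace.
\<close>

definition eigenvalue_vector ::
    "('k::real_or_complex \<Rightarrow> 'v::ab_group_add \<Rightarrow> 'v) \<Rightarrow> 'v set \<Rightarrow> ('v \<Rightarrow> 'v) \<Rightarrow> real list" where
  "eigenvalue_vector smul S B = rev (sorted_list_of_multiset
     (\<Sum>\<mu> \<in> {\<mu>. \<exists>v\<in>eigenspace smul S B \<mu>. v \<noteq> 0}.
        replicate_mset (vector_space.dim smul (eigenspace smul S B \<mu>)) \<mu>))"

definition singular_values ::
    "('k::real_or_complex \<Rightarrow> 'v::ab_group_add \<Rightarrow> 'v) \<Rightarrow> ('v \<Rightarrow> 'v \<Rightarrow> 'k) \<Rightarrow> ('v \<Rightarrow> 'v) \<Rightarrow> real list" where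
  "singular_values smul ip B = map sqrt (eigenvalue_vector smul UNIV (adjoint_op ip B \<circ> B))"

text \<open>
  The singular values of \<open>P\<^sub>X P\<^sub>Y\<close> lie in \<open>[0, 1]\<close>, so \<open>arccos\<close> maps them to the unique angles in
  \<open>[0, \<pi>/2]\<close> with the prescribed cosines, and reverses their order.
\<close>

definition principal_angles ::
    "('k::real_or_complex \<Rightarrow> 'v::ab_group_add \<Rightarrow> 'v) \<Rightarrow> ('v \<Rightarrow> 'v \<Rightarrow> 'k) \<Rightarrow> 'v set \<Rightarrow> 'v set \<Rightarrow> real list" where
  "principal_angles smul ip X Y =
     map arccos (take (min (vector_space.dim smul X) (vector_space.dim smul Y))
       (singular_values smul ip (orth_projector ip X \<circ> orth_projector ip Y)))"

end

theory Submission
  imports Defs "HOL-Computational_Algebra.Fundamental_Theorem_Algebra"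
begin

text \<open>
  For \<open>\<mu> \<noteq> 0\<close>, the operator \<open>P\<^sub>Y\<close> maps the \<open>\<mu>\<close>-eigenspace of \<open>P\<^sub>X P\<^sub>Y\<close> on \<open>X\<close> isomorphically onto that of
  \<open>(P\<^sub>X P\<^sub>Y)* P\<^sub>X P\<^sub>Y = P\<^sub>Y P\<^sub>X P\<^sub>Y\<close>. So the two operators have the same nonzero eigenvalues, which lie in
  \<open>(0, 1]\<close>, and there are at most \<open>dim X\<close> and, since the second operator acts on \<open>Y\<close>, at most \<open>dim Y\<close>
  of them. By the spectral theorem the eigenvalue vectors are completed by zeros. The spectral theorem
  rests on real eigenvectors: a Hermitian operator applied to a fixed vector satisfies a real polynomial
  relation, whose quadratic factors without real roots act injectively.
\<close>

section \<open>Real scalars and factors of real polynomials\<close>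

text \<open>For nonzero \<open>r\<close>, the norm axiom makes \<open>r\<close> times its conjugate
  equal to \<open>r * r\<close>, and one factor \<open>r\<close> cancels.\<close>

lemma conjugate_of_real: "conjugate (of_real r :: 'k::real_or_complex) = of_real r"
proof (cases "r = 0")
  case False
  have "of_real r * conjugate (of_real r :: 'k) = of_real r * of_real r"
    by (simp add: mult_conjugate_eq_norm scaleR_conv_of_real power2_eq_square)
  then show ?thesis using False by simp
qed simp

text \<open>Expanding the squared norm of \<open>1 + z\<close> leaves \<open>z + conjugate z\<close>
  as a difference of real numbers.\<close>

lemma add_conjugate_real:
  fixes z :: "'k::real_or_complex"
  obtains t where "z + conjugate z = of_real t"
proof
  have 1: "conjugate (1::'k) = 1" using conjugate_of_real[of 1, where 'k='k] by simp
  have "(1 + z) * conjugate (1 + z) = 1 + (z + conjugate z) + z * conjugate z"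
    by (simp add: conjugate_dist_add 1 algebra_simps)
  then show "z + conjugate z = of_real ((norm (1 + z))\<^sup>2 - 1 - (norm z)\<^sup>2)"
    by (simp add: mult_conjugate_eq_norm scaleR_conv_of_real algebra_simps)
qed

text \<open>A complex root \<open>z\<close> exists. If it is real, its linear factor splits off;
  otherwise the quadratic (x - a)^2 + b^2 does, with a and b the real and imaginary parts of
  \<open>z\<close>.\<close>

lemma real_poly_factor:
  fixes r :: "real poly"
  assumes "degree r > 0"
  obtains a s where "r = [:- a, 1:] * s"
    | a b s where "b \<noteq> 0" "r = [:a\<^sup>2 + b\<^sup>2, - 2 * a, 1:] * s"
proof -
  have deg: "degree (map_poly complex_of_real r) = degree r"
    by (rule degree_map_poly) simp
  then have "\<not> constant (poly (map_poly complex_of_real r))"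
    using assms by (simp add: constant_degree)
  then obtain z where z: "poly (map_poly complex_of_real r) z = 0"
    using fundamental_theorem_of_algebra by blast
  \<comment> \<open>Evaluation at \<open>z\<close> is additive and multiplicative on real
    polynomials, so it can be applied to a division with remainder.\<close>
  define ev where "ev p = poly (map_poly complex_of_real p) z" for p
  have ev_0: "ev 0 = 0" by (simp add: ev_def)
  have ev_pCons: "ev (pCons a p) = of_real a + z * ev p" for a p
    by (simp add: ev_def map_poly_pCons)
  have ev_smult: "ev (smult c p) = of_real c * ev p" for c p
    by (induction p) (auto simp: ev_0 ev_pCons algebra_simps)
  have ev_add: "ev (p + q) = ev p + ev q" for p q
    by (induction p q rule: poly_induct2) (auto simp: ev_0 ev_pCons algebra_simps)
  have ev_mult: "ev (p * q) = ev p * ev q" for p q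
    by (induction p) (auto simp: ev_0 ev_pCons ev_add ev_smult mult_pCons_left algebra_simps)
  show thesis
  proof (cases "Im z = 0")
    case True
    then have "z = of_real (Re z)" by (simp add: complex_eq_iff)
    then have "ev p = of_real (poly p (Re z))" for p
      by (induction p) (auto simp: ev_0 ev_pCons)
    then have "poly r (Re z) = 0"
      using z by (metis ev_def of_real_eq_0_iff)
    then have "[:- Re z, 1:] dvd r"
      by (simp flip: poly_eq_0_iff_dvd)
    then show thesis using that(1) by (metis dvdE)
  next
    case False
    \<comment> \<open>The real polynomial whose roots are \<open>z\<close> and its
      conjugate.\<close>
    define q where "q = [:(Re z)\<^sup>2 + (Im z)\<^sup>2, - 2 * Re z, 1:]"
    have evq: "ev q = 0"
      by (simp add: q_def ev_pCons ev_0 complex_eq_iff power2_eq_square algebra_simps)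
    have "ev r = ev (q * (r div q) + r mod q)" by simp
    also have "\<dots> = ev (r mod q)" by (simp only: ev_add ev_mult evq mult_zero_left add_0)
    finally have ev_mod: "ev (r mod q) = 0" using z by (simp add: ev_def)
    have "q \<noteq> 0" "degree q = 2" by (simp_all add: q_def)
    then have "degree (r mod q) < 2"
      using degree_mod_less[of q r] by auto
    then have m: "r mod q = [:coeff (r mod q) 0, coeff (r mod q) 1:]"
      by (intro poly_eqI) (auto simp: coeff_pCons coeff_eq_0 split: nat.splits)
    define c d where "c = coeff (r mod q) 0" and "d = coeff (r mod q) 1"
    then have m: "r mod q = [:c, d:]" using m by simp
    have "ev [:c, d:] = 0" using ev_mod m by simp
    then have "of_real c + z * of_real d = 0"
      by (simp add: ev_pCons ev_0)
    \<comment> \<open>A nonreal number is not a root of a nonzero real polynomial of degree at most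
      1.\<close>
    then have "d = 0" "c = 0" using False by (auto simp: complex_eq_iff)
    then have "r mod q = 0" using m by simp
    then have "r = q * (r div q)"
      by (metis add.right_neutral mult_div_mod_eq)
    then show thesis using that(2)[of "Im z" "Re z" "r div q"] False by (simp add: q_def)
  qed
qed

section \<open>Inner products and orthogonal projectors\<close>

context finite_dimensional_inner_product_space
begin

lemma ip_add_right: "ip z (x + y) = ip z x + ip z y"
  by (metis ip_add_left ip_commute conjugate_dist_add)

lemma ip_scale_right: "ip x (smul c y) = conjugate c * ip x y"
  by (metis ip_scale_left ip_commute conjugate_dist_mul)

lemma ip_scale_right_real: "ip x (smul (of_real c) y) = of_real c * ip x y"
  by (simp add: ip_scale_right conjugate_of_real)

lemma ip_zero_left [simp]: "ip 0 x = 0"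
  using ip_add_left[of 0 0 x] by simp

lemma ip_zero_right [simp]: "ip x 0 = 0"
  using ip_add_right[of x 0 0] by simp

lemma ip_minus_left: "ip (- x) y = - ip x y"
  using ip_add_left[of "- x" x y] by (simp add: eq_neg_iff_add_eq_0)

lemma ip_diff_left: "ip (x - y) z = ip x z - ip y z"
  using ip_add_left[of x "- y" z] by (simp add: ip_minus_left)

lemma ip_diff_right: "ip z (x - y) = ip z x - ip z y"
  using ip_add_right[of z "x - y" y] by simp

lemma ip_sum_left: "ip (sum f A) y = (\<Sum>i\<in>A. ip (f i) y)"
  by (induction A rule: infinite_finite_induct) (auto simp: ip_add_left)

lemma ip_self_eq_0 [simp]: "ip x x = 0 \<longleftrightarrow> x = 0"
  by (metis ip_pos ip_zero_left less_irrefl of_real_eq_0_iff)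

lemma ip_self_nonneg: obtains r where "r \<ge> 0" "ip x x = of_real r"
  by (metis ip_pos ip_self_eq_0 less_le of_real_0 order_refl)

lemma ip_eq_0_commute: "ip x y = 0 \<longleftrightarrow> ip y x = 0"
  by (metis ip_commute conjugate_zero)

lemma ip_ext_right: "(\<And>z. ip z x = ip z y) \<Longrightarrow> x = y"
  by (metis ip_diff_right eq_iff_diff_eq_0 ip_self_eq_0)

lemma orthogonal_span:
  assumes "\<And>x. x \<in> B \<Longrightarrow> ip v x = 0" "y \<in> span B"
  shows "ip v y = 0"
  using assms(2) by (induction rule: span_induct_alt) (auto simp: ip_add_right ip_scale_right assms(1))

text \<open>A Gram-Schmidt step: the part \<open>e\<close> of the new generator orthogonal to the
  old span supplies one more component of the projection.\<close>

lemma orth_projection_span_exists: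
  assumes "finite B"
  shows "\<exists>p\<in>span B. \<forall>x\<in>span B. ip (v - p) x = 0"
  using assms
proof (induction B arbitrary: v)
  case empty
  then show ?case by auto
next
  case (insert b B)
  obtain q where q: "q \<in> span B" "\<And>x. x \<in> span B \<Longrightarrow> ip (b - q) x = 0"
    using insert.IH[of b] by blast
  obtain p where p: "p \<in> span B" "\<And>x. x \<in> span B \<Longrightarrow> ip (v - p) x = 0"
    using insert.IH[of v] by blast
  define e where "e = b - q"
  define c where "c = ip v e / ip e e"
  have sub: "span B \<subseteq> span (insert b B)" by (rule span_mono) auto
  have e: "e \<in> span (insert b B)"
    unfolding e_def using q sub by (intro span_diff) (auto intro: span_base)
  \<comment> \<open>If \<open>b\<close> already lies in the old span, then \<open>e = 0\<close> and
    both sides vanish.\<close>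
  have c: "c * ip e e = ip v e"
    by (cases "e = 0") (auto simp: c_def)
  have ep: "ip p e = 0"
    using q(2)[OF p(1)] by (simp add: e_def ip_eq_0_commute)
  show ?case
  proof (intro bexI ballI)
    show "p + smul c e \<in> span (insert b B)"
      using p(1) sub e by (intro span_add span_scale) auto
    fix x assume "x \<in> span (insert b B)"
    then show "ip (v - (p + smul c e)) x = 0"
    proof (rule orthogonal_span[rotated])
      fix y assume y: "y \<in> insert b B"
      have B: "ip (v - (p + smul c e)) y = 0" if "y \<in> span B" for y
        using p(2)[OF that] q(2)[OF that]
        by (simp add: ip_diff_left ip_add_left ip_scale_left e_def)
      \<comment> \<open>As \<open>b = e + q\<close>, the choice of \<open>c\<close> handles
        \<open>e\<close>, and the old span handles \<open>q\<close>.\<close>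
      have "ip (v - (p + smul c e)) b = ip (v - (p + smul c e)) e + ip (v - (p + smul c e)) q"
        by (simp add: e_def flip: ip_add_right)
      also have "\<dots> = 0"
        using B[OF q(1)] c ep by (simp add: ip_diff_left ip_add_left ip_scale_left)
      finally show "ip (v - (p + smul c e)) y = 0"
        using y B span_base by auto
    qed
  qed
qed

text \<open>The difference of two candidates lies in \<open>X\<close> and is orthogonal to itself.
  Later facts about the projector use this characterization instead of the definite
  description.\<close>

lemma orth_projector_unique:
  assumes "subspace X" "p \<in> X" "\<And>x. x \<in> X \<Longrightarrow> ip (v - p) x = 0"
  shows "orth_projector ip X v = p"
  unfolding orth_projector_def
proof (rule the_equality)
  fix q assume q: "q \<in> X \<and> (\<forall>x\<in>X. ip (v - q) x = 0)"
  then have "ip (v - p - (v - q)) (q - p) = 0"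
    using assms subspace_diff ip_diff_left by simp
  then show "q = p" by simp
qed (use assms in auto)

lemma orth_projector:
  assumes "subspace X"
  shows "orth_projector ip X v \<in> X" and "x \<in> X \<Longrightarrow> ip (v - orth_projector ip X v) x = 0"
proof -
  obtain B where B: "B \<subseteq> X" "independent B" "X \<subseteq> span B"
    using basis_exists by metis
  then have "span B = X" "finite B"
    using assms span_minimal finiteI_independent by blast+
  then obtain p where "p \<in> X" "\<And>x. x \<in> X \<Longrightarrow> ip (v - p) x = 0"
    using orth_projection_span_exists by metis
  with orth_projector_unique[OF assms] show "orth_projector ip X v \<in> X"
    and "x \<in> X \<Longrightarrow> ip (v - orth_projector ip X v) x = 0"
    by auto
qed

lemma orth_projector_fixes:
  assumes "subspace X" "x \<in> X" shows "orth_projector ip X x = x"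
  using assms by (intro orth_projector_unique) auto

lemma linear_orth_projector:
  assumes "subspace X"
  shows "Vector_Spaces.linear smul smul (orth_projector ip X)"
proof unfold_locales
  let ?P = "orth_projector ip X"
  note P = orth_projector[OF assms]
  fix x y c
  have "?P x + ?P y \<in> X" "smul c (?P x) \<in> X"
    using P(1) assms by (simp_all add: subspace_add subspace_scale)
  moreover have "ip (x + y - (?P x + ?P y)) z = 0" if "z \<in> X" for z
    using P(2)[OF that, of x] P(2)[OF that, of y]
    by (simp only: add_diff_add ip_add_left add_0)
  moreover have "ip (smul c x - smul c (?P x)) z = 0" if "z \<in> X" for z
    using P(2)[OF that, of x]
    by (simp only: scale_right_diff_distrib[symmetric] ip_scale_left mult_zero_right)
  ultimately show "?P (x + y) = ?P x + ?P y" "?P (smul c x) = smul c (?P x)"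
    using orth_projector_unique[OF assms] by blast+
qed

text \<open>Both sides equal the inner product of the projections of \<open>x\<close> and
  \<open>y\<close>.\<close>

lemma orth_projector_self_adjoint:
  assumes "subspace X"
  shows "ip (orth_projector ip X x) y = ip x (orth_projector ip X y)"
proof -
  let ?P = "orth_projector ip X"
  have "ip (?P x) (y - ?P y) = 0"
    using orth_projector[OF assms] ip_eq_0_commute by blast
  moreover have "ip (x - ?P x) (?P y) = 0"
    using orth_projector[OF assms] by blast
  ultimately show ?thesis by (simp add: ip_diff_left ip_diff_right)
qed

section \<open>Linear dependence and dimensions of orthogonal sums\<close>

text \<open>The coefficients are attached to indices instead of vectors, which allows
  \<open>f\<close> to repeat values.\<close>

lemma span_image_lessThan:
  assumes "x \<in> span (f ` {..<n::nat})"
  obtains c where "x = (\<Sum>i<n. smul (c i) (f i))"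
  using assms
proof (induction n arbitrary: x thesis)
  case (Suc n)
  have "x \<in> span (insert (f n) (f ` {..<n}))"
    using Suc.prems(2) by (simp add: lessThan_Suc)
  then obtain k where "x - smul k (f n) \<in> span (f ` {..<n})"
    by (auto simp: span_breakdown_eq)
  then obtain c where c: "x - smul k (f n) = (\<Sum>i<n. smul (c i) (f i))"
    using Suc.IH by blast
  show ?case
    by (rule Suc.prems(1)[of "c(n := k)"]) (use c in \<open>simp add: algebra_simps\<close>)
qed simp

text \<open>Otherwise every initial segment is independent, and the one of length
  \<open>Suc dimension\<close> is too long.\<close>

lemma sequence_dependent:
  fixes f :: "nat \<Rightarrow> 'v"
  obtains n where "f n \<in> span (f ` {..<n})"
proof (rule ccontr)
  assume "\<not> thesis"
  then have *: "f n \<notin> span (f ` {..<n})" for n using that by blast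
  have "independent (f ` {..<n}) \<and> card (f ` {..<n}) = n" for n
  proof (induction n)
    case (Suc n)
    moreover have "f n \<notin> f ` {..<n}" using *[of n] span_base[of "f n" "f ` {..<n}"] by blast
    ultimately show ?case
      using * by (simp add: lessThan_Suc independent_insertI)
  qed (simp add: independent_empty)
  then have "Suc dimension \<le> dim (f ` {..<Suc dimension})"
    by (metis dim_eq_card_independent order_refl)
  then show False using dim_subset_UNIV[of "f ` {..<Suc dimension}"] by linarith
qed

text \<open>A vector in both \<open>E k\<close> and the span of the other spaces is orthogonal to
  itself, so the dimension formula for sums has no intersection term.\<close>

lemma sum_dim_orthogonal:
  assumes "finite F"
    and "\<And>i. i \<in> F \<Longrightarrow> subspace (E i)"
    and "\<And>i j x y. i \<in> F \<Longrightarrow> j \<in> F \<Longrightarrow> i \<noteq> j \<Longrightarrow> x \<in> E i \<Longrightarrow> y \<in> E j \<Longrightarrow> ip x y = 0"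
  shows "dim (span (\<Union>i\<in>F. E i)) = (\<Sum>i\<in>F. dim (E i))"
  using assms
proof (induction F)
  case (insert k F)
  let ?W = "span (\<Union>i\<in>F. E i)"
  have k: "subspace (E k)" using insert.prems by simp
  have "x = 0" if x: "x \<in> E k" "x \<in> ?W" for x
  proof -
    have "ip x x = 0"
      using insert.prems(2) insert.hyps x(1) by (intro orthogonal_span[OF _ x(2)]) fastforce
    then show ?thesis by simp
  qed
  then have "dim (E k \<inter> ?W) = 0" unfolding dim_eq_0 by blast
  moreover have "span (\<Union>i\<in>insert k F. E i) = {x + y |x y. x \<in> E k \<and> y \<in> ?W}"
    using k by (simp add: span_Un span_eq_iff[THEN iffD2])
  moreover have "dim ?W = (\<Sum>i\<in>F. dim (E i))"
    by (rule insert.IH) (use insert.prems in blast)+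
  ultimately show ?case
    using dim_sums_Int[OF k subspace_span, of "\<Union>i\<in>F. E i"] insert.hyps by (simp del: dim_span dim_eq_0)
qed simp

end

section \<open>Polynomials in a Hermitian operator and real eigenvectors\<close>

text \<open>Linearity is global, while symmetry refers to an invariant subspace \<open>S\<close>.
  The same map can thus be studied on several subspaces.\<close>

locale hermitian_operator =
  finite_dimensional_inner_product_space smul Basis ip
  for smul :: "'k::real_or_complex \<Rightarrow> 'v::ab_group_add \<Rightarrow> 'v" and Basis :: "'v set"
    and ip :: "'v \<Rightarrow> 'v \<Rightarrow> 'k" +
  fixes S :: "'v set" and A :: "'v \<Rightarrow> 'v"
  assumes linear_op: "Vector_Spaces.linear smul smul A"
    and subspace_S: "subspace S"
    and op_in: "x \<in> S \<Longrightarrow> A x \<in> S"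
    and op_self_adjoint: "x \<in> S \<Longrightarrow> y \<in> S \<Longrightarrow> ip (A x) y = ip x (A y)"
begin

sublocale op: Vector_Spaces.linear smul smul A
  by (rule linear_op)

definition poly_op :: "real poly \<Rightarrow> 'v \<Rightarrow> 'v" where
  "poly_op p v = foldr (\<lambda>a w. smul (of_real a) v + A w) (coeffs p) 0"

lemma poly_op_0 [simp]: "poly_op 0 v = 0"
  by (simp add: poly_op_def)

lemma poly_op_pCons [simp]: "poly_op (pCons a p) v = smul (of_real a) v + A (poly_op p v)"
  by (cases "p = 0 \<and> a = 0") (auto simp: poly_op_def cCons_def op.zero)

lemma poly_op_add: "poly_op (p + q) v = poly_op p v + poly_op q v"
  by (induction p q rule: poly_induct2) (auto simp: op.add scale_left_distrib)

lemma poly_op_smult: "poly_op (smult c p) v = smul (of_real c) (poly_op p v)"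
  by (induction p) (auto simp: op.scale scale_right_distrib)

lemma poly_op_mult: "poly_op (p * q) v = poly_op p (poly_op q v)"
  by (induction p) (auto simp: poly_op_add poly_op_smult mult_pCons_left)

lemma poly_op_monom: "poly_op (monom a n) v = smul (of_real a) ((A ^^ n) v)"
  by (induction n) (auto simp: monom_0 monom_Suc op.zero op.scale)

lemma poly_op_sum: "poly_op (sum f I) v = (\<Sum>i\<in>I. poly_op (f i) v)"
  by (induction I rule: infinite_finite_induct) (auto simp: poly_op_add)

lemma poly_op_in: "v \<in> S \<Longrightarrow> poly_op p v \<in> S"
  by (induction p) (auto intro: subspace_0 subspace_add subspace_scale subspace_S op_in)

lemma funpow_in: "x \<in> S \<Longrightarrow> (A ^^ n) x \<in> S"
  by (induction n) (auto intro: op_in)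

lemma funpow_self_adjoint:
  assumes "x \<in> S" "y \<in> S" shows "ip ((A ^^ n) x) y = ip x ((A ^^ n) y)"
  using assms
proof (induction n arbitrary: y)
  case (Suc n)
  then show ?case
    using op_self_adjoint[OF funpow_in[of x n] Suc.prems(2)] op_in
    by (simp add: funpow_swap1)
qed simp

text \<open>
  Since \<open>\<langle>A\<^sup>i v, A\<^sup>j v\<rangle>\<close> is invariant under conjugation, conjugating the coefficients of a linear
  dependence among the \<open>A\<^sup>i v\<close> gives another one; the sum of the two has real coefficients.
\<close>

lemma real_annihilating_poly:
  assumes v: "v \<in> S"
  obtains p where "p \<noteq> 0" "poly_op p v = 0"
proof -
  define f where "f i = (A ^^ i) v" for i
  have g: "conjugate (ip (f i) (f j)) = ip (f i) (f j)" for i j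
  proof -
    \<comment> \<open>The value depends only on \<open>i + j\<close>, so swapping the arguments,
      which conjugates it, changes nothing.\<close>
    have "ip (f i) (f j) = ip v ((A ^^ (i + j)) v)"
      by (simp add: f_def funpow_self_adjoint[OF v funpow_in[OF v]] funpow_add)
    also have "\<dots> = ip (f j) (f i)"
      by (simp add: f_def funpow_self_adjoint[OF v funpow_in[OF v]] funpow_add add.commute[of i])
    finally show ?thesis by (simp flip: ip_commute)
  qed
  obtain n where "f n \<in> span (f ` {..<n})"
    using sequence_dependent .
  then obtain c where c: "f n = (\<Sum>i<n. smul (c i) (f i))"
    by (rule span_image_lessThan)
  define d where "d = f n - (\<Sum>i<n. smul (conjugate (c i)) (f i))"
  \<comment> \<open>Pairing with \<open>f j\<close> gives the conjugate of the original relation;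
    thus \<open>d\<close> is orthogonal to a span that contains it.\<close>
  have "ip d (f j) = 0" for j
  proof -
    have "ip d (f j) = ip (f n) (f j) - (\<Sum>i<n. conjugate (c i) * ip (f i) (f j))"
      by (simp add: d_def ip_diff_left ip_sum_left ip_scale_left)
    also have "(\<Sum>i<n. conjugate (c i) * ip (f i) (f j)) = conjugate (\<Sum>i<n. c i * ip (f i) (f j))"
      by (simp add: sum_conjugate conjugate_dist_mul g)
    also have "(\<Sum>i<n. c i * ip (f i) (f j)) = ip (f n) (f j)"
      by (subst c) (simp add: ip_sum_left ip_scale_left)
    finally show ?thesis by (simp add: g)
  qed
  moreover have "d \<in> span (range f)"
    unfolding d_def by (intro span_diff span_sum span_scale span_base) auto
  ultimately have "ip d d = 0"
    using orthogonal_span[of "range f" d d] by blast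
  then have c': "f n = (\<Sum>i<n. smul (conjugate (c i)) (f i))"
    by (simp add: d_def)
  obtain t where t: "c i + conjugate (c i) = of_real (t i)" for i
  proof -
    have "\<forall>i. \<exists>t. c i + conjugate (c i) = of_real t" by (metis add_conjugate_real)
    then show thesis using that by metis
  qed
  \<comment> \<open>Each of the two added relations contributes one \<open>f n\<close>, hence the
    coefficient 2, which makes \<open>p\<close> nonzero.\<close>
  define p where "p = monom 2 n - (\<Sum>i<n. monom (t i) i)"
  have "coeff p n = 2"
    by (simp add: p_def coeff_sum)
  then have "p \<noteq> 0" by auto
  have "smul 2 (f n) = f n + f n"
    using scale_left_distrib[of 1 1 "f n"] by simp
  also have "\<dots> = (\<Sum>i<n. smul (c i) (f i)) + (\<Sum>i<n. smul (conjugate (c i)) (f i))"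
    by (metis c c')
  also have "\<dots> = (\<Sum>i<n. smul (of_real (t i)) (f i))"
    by (simp flip: sum.distrib t add: scale_left_distrib)
  finally have 1: "smul 2 (f n) = (\<Sum>i<n. smul (of_real (t i)) (f i))" .
  have "poly_op (p + (\<Sum>i<n. monom (t i) i)) v = smul 2 (f n)"
    by (simp add: p_def poly_op_monom f_def)
  then have "poly_op p v = 0"
    by (simp add: poly_op_add poly_op_sum poly_op_monom 1 flip: f_def)
  with \<open>p \<noteq> 0\<close> show thesis using that by blast
qed

text \<open>Induction on the degree. After splitting off a factor, put
  \<open>u = poly_op s w\<close>. If \<open>u = 0\<close>, the cofactor \<open>s\<close> of smaller
  degree annihilates \<open>w\<close>. A linear factor with \<open>u\<close> nonzero makes
  \<open>u\<close> an eigenvector; a quadratic factor forces \<open>u = 0\<close>.\<close>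

lemma eigenvector_of_annihilating_poly:
  assumes "r \<noteq> 0" "w \<in> S" "w \<noteq> 0" "poly_op r w = 0"
  shows "\<exists>a. \<exists>u\<in>S. u \<noteq> 0 \<and> A u = smul (of_real a) u"
  using assms
proof (induction "degree r" arbitrary: r rule: less_induct)
  case less
  show ?case
  proof (cases "degree r = 0")
    case True
    then obtain c where "r = [:c:]" by (rule degree_eq_zeroE)
    then show ?thesis using less.prems by (simp add: op.zero)
  next
    case False
    then have "degree r > 0" by simp
    then show ?thesis
    proof (cases rule: real_poly_factor)
      case (1 a s)
      define u where "u = poly_op s w"
      have "A u = smul (of_real a) u"
      proof -
        have "poly_op [:- a, 1:] u = 0" using less.prems(4) by (simp only: 1 poly_op_mult u_def)
        then show ?thesis by (simp add: op.zero)
      qed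
      moreover have "u \<in> S" using less.prems poly_op_in by (simp add: u_def)
      moreover have ?thesis if "u = 0"
      proof -
        have "s \<noteq> 0" using less.prems(1) 1 by auto
        then have "degree s < degree r" using degree_mult_eq[of "[:- a, 1:]" s] by (simp only: 1) simp
        with \<open>s \<noteq> 0\<close> show ?thesis using less.hyps[of s] that less.prems by (simp add: u_def)
      qed
      ultimately show ?thesis by blast
    next
      case (2 a b s)
      define u where "u = poly_op s w"
      define y where "y = A u - smul (of_real a) u"
      have u: "u \<in> S" using less.prems poly_op_in by (simp add: u_def)
      then have y: "y \<in> S"
        unfolding y_def by (intro subspace_diff subspace_scale subspace_S op_in)
      have "A y - smul (of_real a) y + smul (of_real (b\<^sup>2)) u = 0"
      proof -
        have "smul (of_real (a\<^sup>2 + b\<^sup>2)) u + (smul (of_real (- 2 * a)) (A u) + A (A u)) = 0"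
        proof -
          have "poly_op [:a\<^sup>2 + b\<^sup>2, - 2 * a, 1:] u = 0"
            using less.prems(4) by (simp only: 2 poly_op_mult u_def)
          then show ?thesis by (simp add: op.zero op.add op.scale op.diff)
        qed
        moreover have "smul (of_real (- 2 * a)) (A u) = - smul (of_real a) (A u) - smul (of_real a) (A u)"
          by (simp flip: scale_minus_left scale_left_diff_distrib)
        ultimately show ?thesis
          by (simp add: y_def op.diff op.scale scale_right_diff_distrib scale_left_distrib power2_eq_square
              algebra_simps)
      qed
      then have "ip (A y - smul (of_real a) y + smul (of_real (b\<^sup>2)) u) u = 0"
        by (simp only: ip_zero_left)
      \<comment> \<open>Moving \<open>A - a\<close> to the second argument turns the pairing of (A -
        a)y with \<open>u\<close> into \<open>ip y y\<close>. A sum of two nonnegative terms is then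
        zero.\<close>
      then have "ip y y + of_real (b\<^sup>2) * ip u u = 0"
        using op_self_adjoint[OF y u]
        by (simp add: y_def[THEN arg_cong, of "ip y"] ip_add_left ip_diff_left ip_diff_right
            ip_scale_left ip_scale_right_real)
      moreover obtain ry where "ry \<ge> 0" "ip y y = of_real ry" by (rule ip_self_nonneg)
      moreover obtain ru where ru: "ru \<ge> 0" "ip u u = of_real ru" by (rule ip_self_nonneg)
      ultimately have "of_real (ry + b\<^sup>2 * ru) = (0::'k)" and "ry \<ge> 0" by auto
      then have "ry + b\<^sup>2 * ru = 0" and "ry \<ge> 0" by (simp_all only: of_real_eq_0_iff)
      moreover have "b\<^sup>2 * ru \<ge> 0" using ru by simp
      ultimately have "b\<^sup>2 * ru = 0" by linarith
      then have "u = 0"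
        using ru 2(1) by simp
      have "s \<noteq> 0" using less.prems(1) 2 by auto
      then have "degree s < degree r" using degree_mult_eq[of "[:a\<^sup>2 + b\<^sup>2, - 2 * a, 1:]" s] by (simp only: 2) simp
      with \<open>s \<noteq> 0\<close> show ?thesis
        using less.hyps[of s] \<open>u = 0\<close> less.prems by (simp add: u_def)
    qed
  qed
qed

lemma eigenvector_exists:
  assumes "v \<in> S" "v \<noteq> 0"
  obtains a u where "u \<in> S" "u \<noteq> 0" "A u = smul (of_real a) u"
proof -
  obtain p where "p \<noteq> 0" "poly_op p v = 0"
    using real_annihilating_poly[OF assms(1)] .
  then show thesis
    using eigenvector_of_annihilating_poly[OF _ assms] that by blast
qed

section \<open>Eigenspace decomposition and the list of eigenvalues\<close>

abbreviation "E \<equiv> eigenspace smul S A"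

lemma subspace_eigenspace: "subspace (E \<mu>)"
  using subspace_S
  by (simp add: subspace_def eigenspace_def op.zero op.add op.scale scale_right_distrib mult.commute)

lemma eigenspace_orthogonal:
  assumes "x \<in> E \<mu>" "y \<in> E \<nu>" "\<mu> \<noteq> \<nu>"
  shows "ip x y = 0"
proof -
  have "of_real \<mu> * ip x y = of_real \<nu> * ip x y"
    using assms op_self_adjoint[of x y]
    by (simp add: eigenspace_def ip_scale_left ip_scale_right_real)
  then show ?thesis using assms by simp
qed

text \<open>Nonzero, mutually orthogonal eigenspaces have dimensions adding up to at most
  \<open>dimension\<close>. Finiteness gives the sum in \<open>eigenvalue_vector\<close> its
  intended meaning.\<close>

lemma finite_eigenvalues: "finite {\<mu>. \<exists>v\<in>E \<mu>. v \<noteq> 0}" (is "finite ?M")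
proof -
  have "card F \<le> dimension" if F: "F \<subseteq> ?M" "finite F" for F
  proof -
    have "1 \<le> dim (E \<mu>)" if "\<mu> \<in> F" for \<mu>
      using F that dim_eq_0[of "E \<mu>"] by fastforce
    then have "card F \<le> (\<Sum>\<mu>\<in>F. dim (E \<mu>))"
      using sum_mono[of F "\<lambda>_. 1" "\<lambda>\<mu>. dim (E \<mu>)"] by simp
    also have "\<dots> = dim (span (\<Union>\<mu>\<in>F. E \<mu>))"
      using F(2) subspace_eigenspace eigenspace_orthogonal by (intro sum_dim_orthogonal[symmetric])
    also have "\<dots> \<le> dimension" by (rule dim_subset_UNIV)
    finally show ?thesis .
  qed
  then show ?thesis
    using finite_if_finite_subsets_card_bdd[of ?M dimension] by blast
qed

text \<open>The orthogonal complement \<open>R\<close> of the eigenspaces in \<open>S\<close> is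
  invariant. If nonzero, it contains an eigenvector, which is then orthogonal to itself.\<close>

lemma span_eigenspaces: "span (\<Union>\<mu>\<in>{\<mu>. \<exists>v\<in>E \<mu>. v \<noteq> 0}. E \<mu>) = S" (is "?W = S")
proof
  show W: "?W \<subseteq> S"
    by (rule span_minimal[OF _ subspace_S]) (auto simp: eigenspace_def)
  define R where "R = {x \<in> S. \<forall>\<mu>. \<forall>y\<in>E \<mu>. ip x y = 0}"
  interpret R: hermitian_operator smul Basis ip R A
  proof
    show "subspace R"
      using subspace_S by (simp add: R_def subspace_def ip_add_left ip_scale_left)
    fix x assume x: "x \<in> R"
    then have "ip (A x) y = 0" if "y \<in> E \<mu>" for \<mu> y
      using that op_self_adjoint[of x y] by (auto simp: R_def eigenspace_def ip_scale_right)
    then show "A x \<in> R" using x op_in by (simp add: R_def)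
  qed (auto simp: R_def op_self_adjoint)
  show "S \<subseteq> ?W"
  proof
    fix v assume v: "v \<in> S"
    let ?p = "orth_projector ip ?W v"
    have p: "?p \<in> ?W" by (rule orth_projector) simp
    have "v - ?p \<in> R"
    proof -
      have "ip (v - ?p) y = 0" if "y \<in> E \<mu>" for \<mu> y
      \<comment> \<open>A nonzero \<open>y\<close> makes \<mu> an eigenvalue, so that
        \<open>E \<mu>\<close> occurs in the union.\<close>
      proof (cases "y = 0")
        case False
        then have "y \<in> ?W" using that by (intro span_base) auto
        then show ?thesis by (intro orth_projector) auto
      qed simp
      then show ?thesis
        using v p W subspace_diff[OF subspace_S] by (auto simp: R_def)
    qed
    moreover have False if nz: "v - ?p \<in> R" "v - ?p \<noteq> 0"
    proof -
      obtain a u where u: "u \<in> R" "u \<noteq> 0" "A u = smul (of_real a) u"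
        using R.eigenvector_exists[OF nz] .
      then have "u \<in> E a" by (simp add: R_def eigenspace_def)
      then have "ip u u = 0" using u by (auto simp: R_def)
      then show False using u by simp
    qed
    ultimately have "v = ?p" by auto
    then show "v \<in> ?W" using p by simp
  qed
qed

text \<open>The eigenvalues before sorting, so that spectra can be compared through
  multiplicities.\<close>

definition eigenvalue_mset :: "real multiset" where
  "eigenvalue_mset = (\<Sum>\<mu> \<in> {\<mu>. \<exists>v\<in>E \<mu>. v \<noteq> 0}. replicate_mset (dim (E \<mu>)) \<mu>)"

lemma eigenvalue_vector_eq: "eigenvalue_vector smul S A = rev (sorted_list_of_multiset eigenvalue_mset)"
  by (simp add: eigenvalue_vector_def eigenvalue_mset_def)

lemma size_eigenvalue_mset: "size eigenvalue_mset = dim S"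
proof -
  have "size eigenvalue_mset = (\<Sum>\<mu> \<in> {\<mu>. \<exists>v\<in>E \<mu>. v \<noteq> 0}. dim (E \<mu>))"
    by (simp add: eigenvalue_mset_def)
  also have "\<dots> = dim (span (\<Union>\<mu>\<in>{\<mu>. \<exists>v\<in>E \<mu>. v \<noteq> 0}. E \<mu>))"
    using finite_eigenvalues subspace_eigenspace eigenspace_orthogonal
    by (intro sum_dim_orthogonal[symmetric])
  also have "\<dots> = dim S" by (simp only: span_eigenspaces)
  finally show ?thesis .
qed

lemma count_eigenvalue_mset: "count eigenvalue_mset \<mu> = dim (E \<mu>)"
proof -
  have "count eigenvalue_mset \<mu> = (\<Sum>\<nu> \<in> {\<nu>. \<exists>v\<in>E \<nu>. v \<noteq> 0}. if \<nu> = \<mu> then dim (E \<nu>) else 0)"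
    by (auto simp: eigenvalue_mset_def count_sum intro!: sum.cong)
  also have "\<dots> = (if \<exists>v\<in>E \<mu>. v \<noteq> 0 then dim (E \<mu>) else 0)"
    using finite_eigenvalues by (simp add: sum.delta)
  also have "\<dots> = dim (E \<mu>)"
    using dim_eq_0[of "E \<mu>"] by auto
  finally show ?thesis .
qed

lemma eigenvalue_mset_eigenvector:
  assumes "\<mu> \<in># eigenvalue_mset"
  obtains v where "v \<in> S" "v \<noteq> 0" "A v = smul (of_real \<mu>) v"
proof -
  have "dim (E \<mu>) \<noteq> 0"
    using assms by (simp flip: count_eigenvalue_mset)
  then show thesis
    using that unfolding dim_eq_0 by (auto simp: eigenspace_def)
qed

end

text \<open>Zeros are the least elements and come last in nonincreasing order; the size difference
  counts them.\<close>

lemma rev_sorted_list_of_multiset_nonneg: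
  fixes M :: "'a::{linorder, zero} multiset"
  assumes "\<And>x. x \<in># M \<Longrightarrow> x \<ge> 0"
  shows "rev (sorted_list_of_multiset M) =
    rev (sorted_list_of_multiset {#x \<in># M. x \<noteq> 0#}) @
    replicate (size M - size {#x \<in># M. x \<noteq> 0#}) 0"
proof -
  let ?N = "{#x \<in># M. x \<noteq> 0#}"
  let ?xs = "replicate (size M - size ?N) 0 @ sorted_list_of_multiset ?N"
  have split: "M = ?N + replicate_mset (count M 0) 0"
    by (rule multiset_eqI) simp
  then have "size M = size ?N + count M 0"
    by (metis size_union size_replicate_mset)
  then have "mset ?xs = M"
    using split by (simp add: add.commute)
  moreover have "sorted ?xs"
    using assms by (auto simp: sorted_append)
  ultimately have "sorted_list_of_multiset M = ?xs"
    by (metis sorted_list_of_multiset_mset sorted_sort_id)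
  then show ?thesis by simp
qed

section \<open>Products of two orthogonal projectors\<close>

context finite_dimensional_inner_product_space
begin

text \<open>Self-adjointness of the two projectors reverses their order, and nondegeneracy of
  \<open>ip\<close> makes the adjoint unique.\<close>

lemma adjoint_op_orth_projectors:
  assumes "subspace X" "subspace Y"
  shows "adjoint_op ip (orth_projector ip X \<circ> orth_projector ip Y) =
    orth_projector ip Y \<circ> orth_projector ip X"
  unfolding adjoint_op_def
proof (rule the_equality)
  show 1: "\<forall>x y. ip ((orth_projector ip X \<circ> orth_projector ip Y) x) y =
      ip x ((orth_projector ip Y \<circ> orth_projector ip X) y)"
    using assms by (simp add: orth_projector_self_adjoint)
  fix B assume "\<forall>x y. ip ((orth_projector ip X \<circ> orth_projector ip Y) x) y = ip x (B y)"
  then show "B = orth_projector ip Y \<circ> orth_projector ip X"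
    using 1 by (intro ext ip_ext_right) simp
qed

lemma dim_le_of_linear_inj:
  assumes "Vector_Spaces.linear smul smul f" "subspace V" "f ` V \<subseteq> W" "inj_on f V"
  shows "dim V \<le> dim W"
proof -
  interpret finite_dimensional_vector_space_pair_1 smul Basis smul
    by unfold_locales
  have "dim (f ` V) = dim V"
    using assms by (intro dim_image_eq) (simp_all add: span_eq_iff[THEN iffD2])
  then show ?thesis using dim_subset[OF assms(3)] by simp
qed

text \<open>
  \<open>P\<^sub>Y\<close> carries the \<open>\<mu>\<close>-eigenspace of \<open>P\<^sub>X P\<^sub>Y\<close> on \<open>X\<close> onto that of \<open>P\<^sub>Y P\<^sub>X P\<^sub>Y\<close>, with inverse \<open>\<mu>\<^sup>-\<^sup>1 P\<^sub>X\<close>.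
\<close>

lemma dim_eigenspace_projectors:
  fixes \<mu> :: real
  assumes X: "subspace X" and Y: "subspace Y" and S: "Y \<subseteq> S" "subspace S" and \<mu>: "\<mu> \<noteq> 0"
  defines "P \<equiv> orth_projector ip X" and "Q \<equiv> orth_projector ip Y"
  shows "dim (eigenspace smul X (P \<circ> Q) \<mu>) = dim (eigenspace smul S (Q \<circ> P \<circ> Q) \<mu>)"
    (is "dim ?E = dim ?F")
proof -
  interpret P: Vector_Spaces.linear smul smul P
    unfolding P_def by (rule linear_orth_projector[OF X])
  interpret Q: Vector_Spaces.linear smul smul Q
    unfolding Q_def by (rule linear_orth_projector[OF Y])
  have PX: "P x \<in> X" and QY: "Q x \<in> Y" for x
    unfolding P_def Q_def using orth_projector X Y by auto
  have QQ: "Q y = y" if "y \<in> Y" for y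
    unfolding Q_def using that Y by (rule orth_projector_fixes[rotated])
  have cancel: "x = y" if "smul (of_real \<mu>) x = smul (of_real \<mu>) y" for x y
    using that \<mu> by simp
  \<comment> \<open>The multiple \<open>smul (of_real \<mu>) y\<close> is a value of
    \<open>Q\<close>, hence fixed by \<open>Q\<close>; cancel \<mu>.\<close>
  have F: "Q y = y" if y: "y \<in> ?F" for y
  proof -
    have "smul (of_real \<mu>) y = Q (P (Q y))" using y by (simp add: eigenspace_def)
    then have "Q (smul (of_real \<mu>) y) = smul (of_real \<mu>) y" by (simp add: QQ QY)
    then show ?thesis by (simp add: Q.scale cancel)
  qed
  have subspaces: "subspace ?E" "subspace ?F"
    using X S(2)
    by (simp_all add: subspace_def eigenspace_def P.zero P.add P.scale Q.zero Q.add Q.scale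
        scale_right_distrib mult.commute)
  show ?thesis
  proof (rule antisym)
    show "dim ?E \<le> dim ?F"
    proof (rule dim_le_of_linear_inj)
      show "Q ` ?E \<subseteq> ?F"
        using S(1) QY by (auto simp: eigenspace_def QQ Q.scale)
      show "inj_on Q ?E"
      proof (rule inj_onI)
        fix x y assume "x \<in> ?E" "y \<in> ?E" "Q x = Q y"
        \<comment> \<open>Apply \<open>P\<close> to \<open>Q x = Q y\<close>: on \<open>?E\<close>
          the product \<open>P \<circ> Q\<close> is multiplication by \<mu>.\<close>
        then have "smul (of_real \<mu>) x = smul (of_real \<mu>) y" by (simp add: eigenspace_def)
        then show "x = y" by (rule cancel)
      qed
    qed (use subspaces Q.linear_axioms in auto)
    show "dim ?F \<le> dim ?E"
    proof (rule dim_le_of_linear_inj)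
      show "P ` ?F \<subseteq> ?E"
      proof (clarify)
        fix y assume y: "y \<in> ?F"
        then have "Q (P y) = smul (of_real \<mu>) y" using F[OF y] by (simp add: eigenspace_def)
        then show "P y \<in> ?E" by (simp add: eigenspace_def PX P.scale)
      qed
      have "Q (P y) = smul (of_real \<mu>) y" if "y \<in> ?F" for y
        using F[OF that] that by (simp add: eigenspace_def)
      then show "inj_on P ?F"
        by (metis (no_types, lifting) cancel inj_onI)
    qed (use subspaces P.linear_axioms in auto)
  qed
qed

end

section \<open>Comparison of the spectra on X, on Y and on the whole space\<close>

theorem lemma2p8:
  fixes smul :: "'k::real_or_complex \<Rightarrow> 'v::ab_group_add \<Rightarrow> 'v"
    and ip :: "'v \<Rightarrow> 'v \<Rightarrow> 'k"
    and Basis X Y :: "'v set"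
  assumes "finite_dimensional_inner_product_space smul Basis ip"
    and "module.subspace smul X"
    and "module.subspace smul Y"
  shows "eigenvalue_vector smul X (restrict (orth_projector ip X \<circ> orth_projector ip Y) X) =
    map (\<lambda>\<theta>. (cos \<theta>)\<^sup>2) (principal_angles smul ip X Y) @
    replicate (vector_space.dim smul X - vector_space.dim smul Y) 0"
proof -
  interpret finite_dimensional_inner_product_space smul Basis ip by fact
  note X = assms(2) and Y = assms(3)
  define P where "P = orth_projector ip X"
  define Q where "Q = orth_projector ip Y"
  interpret P: Vector_Spaces.linear smul smul P
    unfolding P_def by (rule linear_orth_projector[OF X])
  interpret Q: Vector_Spaces.linear smul smul Q
    unfolding Q_def by (rule linear_orth_projector[OF Y])
  have P: "P x \<in> X" "x \<in> X \<Longrightarrow> P x = x" "ip (P x) y = ip x (P y)" for x y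
    using orth_projector[OF X] orth_projector_fixes[OF X] orth_projector_self_adjoint[OF X]
    by (simp_all add: P_def)
  have Q: "Q x \<in> Y" "x \<in> Y \<Longrightarrow> Q x = x" "ip (Q x) y = ip x (Q y)" for x y
    using orth_projector[OF Y] orth_projector_fixes[OF Y] orth_projector_self_adjoint[OF Y]
    by (simp_all add: Q_def)
  have "Vector_Spaces.linear smul smul (P \<circ> Q)"
    and linear: "Vector_Spaces.linear smul smul (Q \<circ> P \<circ> Q)"
    by (unfold_locales; simp add: P.add P.scale Q.add Q.scale)+
  moreover have "ip (P (Q x)) y = ip x (P (Q y))" if "x \<in> X" "y \<in> X" for x y
    by (metis P(2,3) Q(3) that)
  ultimately interpret A: hermitian_operator smul Basis ip X "P \<circ> Q"
    by (intro hermitian_operator.intro hermitian_operator_axioms.intro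
        finite_dimensional_inner_product_space_axioms X) (simp_all add: P(1))
  interpret C: hermitian_operator smul Basis ip UNIV "Q \<circ> P \<circ> Q"
    by (intro hermitian_operator.intro hermitian_operator_axioms.intro
        finite_dimensional_inner_product_space_axioms linear) (simp_all add: P Q)
  \<comment> \<open>On \<open>Y\<close> the same operator has \<open>dim Y\<close> eigenvalues,
    which bounds the number of nonzero ones.\<close>
  interpret D: hermitian_operator smul Basis ip Y "Q \<circ> P \<circ> Q"
    by (intro hermitian_operator.intro hermitian_operator_axioms.intro
        finite_dimensional_inner_product_space_axioms linear Y)
      (use C.op_self_adjoint in \<open>simp_all add: Q(1)\<close>)
  \<comment> \<open>The nonzero eigenvalues, shared by all three operators.\<close>
  define N where "N = {#\<mu> \<in># A.eigenvalue_mset. \<mu> \<noteq> 0#}"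
  note dims = dim_eigenspace_projectors[OF X Y, folded P_def Q_def]
  have NC: "{#\<mu> \<in># C.eigenvalue_mset. \<mu> \<noteq> 0#} = N"
    using dims[of UNIV]
    by (intro multiset_eqI) (simp add: N_def A.count_eigenvalue_mset C.count_eigenvalue_mset)
  have ND: "{#\<mu> \<in># D.eigenvalue_mset. \<mu> \<noteq> 0#} = N"
    using dims[of Y] Y
    by (intro multiset_eqI) (simp add: N_def A.count_eigenvalue_mset D.count_eigenvalue_mset)
  have size_N: "size N \<le> dim X" "size N \<le> dim Y"
    using size_filter_mset_lesseq[of "\<lambda>\<mu>. \<mu> \<noteq> 0" A.eigenvalue_mset]
      size_filter_mset_lesseq[of "\<lambda>\<mu>. \<mu> \<noteq> 0" D.eigenvalue_mset]
    by (simp_all add: A.size_eigenvalue_mset D.size_eigenvalue_mset ND flip: N_def)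
  have bounds: "0 \<le> \<mu> \<and> \<mu> \<le> 1" if \<mu>: "\<mu> \<in># A.eigenvalue_mset" for \<mu>
  proof -
    obtain v where v: "v \<in> X" "v \<noteq> 0" "P (Q v) = smul (of_real \<mu>) v"
      using A.eigenvalue_mset_eigenvector[OF \<mu>] by auto
    \<comment> \<open>With squared norms \<open>r\<close>, \<open>q\<close>, \<open>t\<close> of
      \<open>v\<close>, \<open>Q v\<close>, \<open>v - Q v\<close>, the eigenvalue is the Rayleigh
      quotient \<open>q / r\<close>, and Pythagoras gives \<open>t = r - q\<close>.\<close>
    obtain r where r: "r > 0" "ip v v = of_real r" using ip_pos[OF v(2)] by blast
    obtain q where q: "q \<ge> 0" "ip (Q v) (Q v) = of_real q" by (rule ip_self_nonneg)
    obtain t where t: "t \<ge> 0" "ip (v - Q v) (v - Q v) = of_real t" by (rule ip_self_nonneg)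
    have "of_real q = ip (P (Q v)) v"
      using v(1) by (simp add: P Q flip: q(2))
    also have "\<dots> = of_real (\<mu> * r)"
      by (simp add: v(3) ip_scale_left r)
    finally have "\<mu> * r = q" by (simp only: of_real_eq_iff)
    then have "\<mu> = q / r" using r by (simp add: field_simps)
    moreover have "of_real t = (of_real (r - q) :: 'k)"
      by (simp add: Q ip_diff_left ip_diff_right flip: t(2) r(2) q(2))
    then have "q \<le> r" using t by (simp only: of_real_eq_iff)
    ultimately show ?thesis using r(1) q(1) by simp
  qed
  have C_nonneg: "0 \<le> \<mu>" if "\<mu> \<in># C.eigenvalue_mset" for \<mu>
  proof (cases "\<mu> = 0")
    case False
    then have "\<mu> \<in># N" using that by (simp flip: NC)
    then show ?thesis using bounds by (simp add: N_def)
  qed simp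
  define L where "L = rev (sorted_list_of_multiset N)"
  have length_L: "length L = size N"
    unfolding L_def by (metis length_rev mset_sorted_list_of_multiset size_mset)
  \<comment> \<open>Restriction changes values only outside \<open>X\<close>, and the eigenspaces
    lie in \<open>X\<close>.\<close>
  have "eigenvalue_vector smul X (restrict (P \<circ> Q) X) = eigenvalue_vector smul X (P \<circ> Q)"
    by (simp add: eigenvalue_vector_def eigenspace_def cong: conj_cong)
  also have "\<dots> = L @ replicate (dim X - length L) 0"
    using rev_sorted_list_of_multiset_nonneg[of A.eigenvalue_mset] bounds
    by (simp add: A.eigenvalue_vector_eq A.size_eigenvalue_mset length_L flip: N_def L_def)
  finally have lhs: "eigenvalue_vector smul X (restrict (P \<circ> Q) X) =
    L @ replicate (dim X - length L) 0" .
  let ?m = "min (dim X) (dim Y)"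
  \<comment> \<open>Idempotence of \<open>P\<close> shortens the product of four projectors to
    three.\<close>
  have "adjoint_op ip (P \<circ> Q) \<circ> (P \<circ> Q) = Q \<circ> P \<circ> Q"
    by (simp add: adjoint_op_orth_projectors[OF X Y, folded P_def Q_def] fun_eq_iff P)
  then have "singular_values smul ip (P \<circ> Q) = map sqrt (L @ replicate (dim UNIV - length L) 0)"
    using rev_sorted_list_of_multiset_nonneg[of C.eigenvalue_mset] C_nonneg
    by (simp add: singular_values_def C.eigenvalue_vector_eq C.size_eigenvalue_mset length_L NC
        del: dim_UNIV flip: L_def)
  \<comment> \<open>Since \<open>L\<close> has at most \<open>?m\<close> entries and
    \<open>?m\<close> is at most the full dimension, truncation removes only zeros.\<close>
  moreover have "take ?m (L @ replicate (dim UNIV - length L) 0) = L @ replicate (?m - length L) 0"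
    using size_N dim_subset[of X UNIV] dim_subset[of Y UNIV]
    by (auto simp: length_L min_def simp del: dim_UNIV)
  ultimately have angles: "principal_angles smul ip X Y =
      map (\<lambda>x. arccos (sqrt x)) (L @ replicate (?m - length L) 0)"
    by (simp add: principal_angles_def take_map comp_def del: map_append flip: P_def Q_def)
  \<comment> \<open>The eigenvalue bounds place \<open>sqrt x\<close> in the range where
    \<open>cos\<close> inverts \<open>arccos\<close>.\<close>
  have "(cos (arccos (sqrt x)))\<^sup>2 = x" if "0 \<le> x" "x \<le> 1" for x
    using that by (simp add: cos_arccos order_trans[of _ 0])
  moreover have "0 \<le> x \<and> x \<le> 1" if "x \<in> set L" for x
    using that bounds by (auto simp: L_def N_def)
  ultimately have "map (\<lambda>\<theta>. (cos \<theta>)\<^sup>2) (principal_angles smul ip X Y) = L @ replicate (?m - length L) 0"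
    by (simp add: angles map_idI)
  \<comment> \<open>With truncated subtraction, \<open>dim X - dim Y\<close> is exactly what
    \<open>?m\<close> lacks to reach \<open>dim X\<close>.\<close>
  moreover have "?m - length L + (dim X - dim Y) = dim X - length L"
    using size_N length_L by auto
  ultimately show ?thesis
    using lhs by (simp add: replicate_add[symmetric] flip: P_def Q_def)
qed

end
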